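(* A general ternary quartic $p \in H_4(\mathbb{C}^3)$ can be written as $$p(x_1,x_2,x_3) = q^2(x_1,x_2,x_3) + \sum_{k=1}^3 \ell_k^4(x_1,x_2,x_3),$$ where $q \in H_2(\mathbb{C}^3)$ and $\ell_1,\ell_2,\ell_3 \in H_1(\mathbb{C}^3)$.
   Context: $H_d(\mathbb{C}^n)$ denotes the complex vector space of homogeneous polynomials of degree $d$ in $n$ variables. "A general $p$ has property P" means P holds for all $p$ in a nonempty Zariski-open subset of $H_d(\mathbb{C}^n)$. *)

theory Defs
  imports Complex_Main
begin

text \<open>Homogeneous polynomials of degree d in n variables over the complex numbers,
  represented by their coefficient functions on exponent vectors.\<close>

definition monomials :: "nat \<Rightarrow> nat \<Rightarrow> (nat \<Rightarrow> nat) set" where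
  "monomials n d = {\<alpha>. (\<forall>i\<ge>n. \<alpha> i = 0) \<and> (\<Sum>i<n. \<alpha> i) = d}"

definition H :: "nat \<Rightarrow> nat \<Rightarrow> ((nat \<Rightarrow> nat) \<Rightarrow> complex) set" where
  "H d n = {c. \<forall>\<alpha>. \<alpha> \<notin> monomials n d \<longrightarrow> c \<alpha> = 0}"

definition peval :: "nat \<Rightarrow> nat \<Rightarrow> ((nat \<Rightarrow> nat) \<Rightarrow> complex) \<Rightarrow> (nat \<Rightarrow> complex) \<Rightarrow> complex" where
  "peval n d c x = (\<Sum>\<alpha>\<in>monomials n d. c \<alpha> * (\<Prod>i<n. x i ^ \<alpha> i))"

inductive_set poly_fun :: "(((nat \<Rightarrow> nat) \<Rightarrow> complex) \<Rightarrow> complex) set" where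
  const: "(\<lambda>c. a) \<in> poly_fun"
| coord: "(\<lambda>c. c \<alpha>) \<in> poly_fun"
| add: "f \<in> poly_fun \<Longrightarrow> g \<in> poly_fun \<Longrightarrow> (\<lambda>c. f c + g c) \<in> poly_fun"
| mult: "f \<in> poly_fun \<Longrightarrow> g \<in> poly_fun \<Longrightarrow> (\<lambda>c. f c * g c) \<in> poly_fun"

definition zariski_closed :: "nat \<Rightarrow> nat \<Rightarrow> ((nat \<Rightarrow> nat) \<Rightarrow> complex) set \<Rightarrow> bool" where
  "zariski_closed d n Z \<longleftrightarrow>
     (\<exists>F \<subseteq> poly_fun. Z = {c \<in> H d n. \<forall>f\<in>F. f c = 0})"

definition zariski_open :: "nat \<Rightarrow> nat \<Rightarrow> ((nat \<Rightarrow> nat) \<Rightarrow> complex) set \<Rightarrow> bool" where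
  "zariski_open d n U \<longleftrightarrow> U \<subseteq> H d n \<and> zariski_closed d n (H d n - U)"

definition general :: "nat \<Rightarrow> nat \<Rightarrow> (((nat \<Rightarrow> nat) \<Rightarrow> complex) \<Rightarrow> bool) \<Rightarrow> bool" where
  "general d n P \<longleftrightarrow> (\<exists>U. zariski_open d n U \<and> U \<noteq> {} \<and> (\<forall>p\<in>U. P p))"

end

theory Submission
  imports Defs "HOL-Analysis.Analysis"
begin

text \<open>Both sides have 15 parameters, so the theorem says that the polynomial map \<open>F\<close> sending
  \<open>(q, l1, l2, l3)\<close> to the coefficients of \<open>q\<^sup>2 + l1\<^sup>4 + l2\<^sup>4 + l3\<^sup>4\<close> is dominant. Its derivative is
  injective at \<open>q = xy + xz + yz\<close>, \<open>l = (x, y, z)\<close>. For an arbitrary polynomial map \<open>F\<close> from \<open>n\<close>-space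
  to itself with this property, every polynomial in \<open>x\<close> is algebraic over the components of \<open>F\<close>, by
  counting monomials. Applied to the coordinates, this gives a hypersurface outside which \<open>F\<close> is proper,
  so that the image is closed there; applied to the Jacobian determinant, it gives a hypersurface outside
  which all preimages are regular points, so that the image is open there. The complement of both
  hypersurfaces is connected, as any two of its points lie on a complex line that meets it in the
  complement of a finite set; hence it lies in the image.\<close>

section \<open>Homogeneous linear systems with more unknowns than equations\<close>

text \<open>Gaussian elimination: an equation with a nonzero coefficient is solved for one unknown,
  which removes one equation and one unknown. Unknowns are indexed by \<open>I\<close>, equations by
  \<open>J\<close>.\<close>

lemma underdetermined_system:
  fixes A :: "'a \<Rightarrow> 'b \<Rightarrow> 'c::field"
  assumes "finite J" "finite I" "card J < card I"
  shows "\<exists>c. (\<exists>i\<in>I. c i \<noteq> 0) \<and> (\<forall>j\<in>J. (\<Sum>i\<in>I. c i * A i j) = 0)"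
  using assms
proof (induction J arbitrary: I A rule: finite_induct)
  case empty
  then have "I \<noteq> {}" by auto
  then show ?case by (intro exI[of _ "\<lambda>_. 1"]) auto
next
  case (insert j J)
  show ?case
  proof (cases "\<forall>i\<in>I. A i j = 0")
    case True
    have "card J < card I" using insert by simp
    from insert.IH[OF insert.prems(1) this, of A] True show ?thesis by auto
  next
    case False
    then obtain k where k: "k \<in> I" "A k j \<noteq> 0" by auto
    \<comment> \<open>The coefficients left after equation \<open>j\<close> has been solved for the
      unknown \<open>k\<close> and substituted into the others.\<close>
    define A' where "A' i j' = A i j' - A i j / A k j * A k j'" for i j'
    have "finite (I - {k})" "card J < card (I - {k})" using insert k by auto
    from insert.IH[OF this, of A'] obtain c where
      c: "\<exists>i\<in>I - {k}. c i \<noteq> 0" "\<forall>j\<in>J. (\<Sum>i\<in>I - {k}. c i * A' i j) = 0" by blast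
    define s where "s = (\<Sum>i\<in>I - {k}. c i * (A i j / A k j))"
    \<comment> \<open>The unknown \<open>k\<close> takes the value that equation \<open>j\<close>
      forces.\<close>
    define c' where "c' = c(k := - s)"
    have split: "(\<Sum>i\<in>I. c' i * A i j') = (\<Sum>i\<in>I - {k}. c i * A i j') - s * A k j'" for j'
    proof -
      have "(\<Sum>i\<in>I. c' i * A i j') = c' k * A k j' + (\<Sum>i\<in>I - {k}. c' i * A i j')"
        using insert.prems(1) k(1) by (rule sum.remove)
      also have "(\<Sum>i\<in>I - {k}. c' i * A i j') = (\<Sum>i\<in>I - {k}. c i * A i j')"
        by (rule sum.cong) (auto simp: c'_def)
      finally show ?thesis by (simp add: c'_def)
    qed
    have "(\<Sum>i\<in>I. c' i * A i j') = 0" if "j' \<in> insert j J" for j'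
    proof (cases "j' = j")
      case True
      then show ?thesis using k(2)
        by (simp add: split s_def sum_distrib_right)
    next
      case False
      then have "(\<Sum>i\<in>I - {k}. c i * A' i j') = 0" using c(2) that by auto
      then show ?thesis
        by (simp add: split A'_def s_def sum_distrib_right right_diff_distrib sum_subtractf mult.assoc)
    qed
    moreover have "\<exists>i\<in>I. c' i \<noteq> 0" using c(1) by (auto simp: c'_def)
    ultimately show ?thesis by blast
  qed
qed

section \<open>Polynomial functions on complex vectors\<close>

inductive_set poly_map :: "(complex^'n \<Rightarrow> complex) set" where
  const: "(\<lambda>x. a) \<in> poly_map"
| coord: "(\<lambda>x. x $ i) \<in> poly_map"
| add: "f \<in> poly_map \<Longrightarrow> g \<in> poly_map \<Longrightarrow> (\<lambda>x. f x + g x) \<in> poly_map"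
| mult: "f \<in> poly_map \<Longrightarrow> g \<in> poly_map \<Longrightarrow> (\<lambda>x. f x * g x) \<in> poly_map"

lemma poly_map_power: "f \<in> poly_map \<Longrightarrow> (\<lambda>x. f x ^ k) \<in> poly_map"
  by (induction k) (auto intro: poly_map.intros)

lemma poly_map_sum: "(\<And>i. i \<in> I \<Longrightarrow> f i \<in> poly_map) \<Longrightarrow> (\<lambda>x. \<Sum>i\<in>I. f i x) \<in> poly_map"
  by (induction I rule: infinite_finite_induct) (auto intro: poly_map.intros)

lemma poly_map_prod: "(\<And>i. i \<in> I \<Longrightarrow> f i \<in> poly_map) \<Longrightarrow> (\<lambda>x. \<Prod>i\<in>I. f i x) \<in> poly_map"
  by (induction I rule: infinite_finite_induct) (auto intro: poly_map.intros)

lemma poly_map_compose: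
  assumes "f \<in> poly_map" "\<And>i. (\<lambda>x. F x $ i) \<in> poly_map"
  shows "(\<lambda>x. f (F x)) \<in> poly_map"
  using assms(1) by induction (auto intro: poly_map.intros assms(2))

lemma poly_map_det:
  fixes A :: "'n::finite \<Rightarrow> 'n \<Rightarrow> complex^'m \<Rightarrow> complex"
  assumes "\<And>i j. A i j \<in> poly_map"
  shows "(\<lambda>x. det (\<chi> i j. A i j x)) \<in> poly_map"
  unfolding det_def
  by (auto intro!: poly_map_sum poly_map_prod poly_map.mult poly_map.const assms)

text \<open>On a complex line every polynomial becomes univariate, so the finiteness of its roots
  can be used. The later arguments about zero sets all go through such a line.\<close>

lemma poly_map_line:
  assumes "f \<in> poly_map"
  shows "\<exists>p. \<forall>t. f (x + t *s v) = poly p t"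
  using assms
proof induction
  case (const a)
  show ?case by (rule exI[of _ "[:a:]"]) simp
next
  case (coord i)
  show ?case by (rule exI[of _ "[:x $ i, v $ i:]"]) (simp add: mult.commute)
next
  case (add f g)
  then obtain p q where "\<forall>t. f (x + t *s v) = poly p t" "\<forall>t. g (x + t *s v) = poly q t" by blast
  then show ?case by (intro exI[of _ "p + q"]) simp
next
  case (mult f g)
  then obtain p q where "\<forall>t. f (x + t *s v) = poly p t" "\<forall>t. g (x + t *s v) = poly q t" by blast
  then show ?case by (intro exI[of _ "p * q"]) simp
qed

text \<open>That the partial derivatives are polynomials again makes the Jacobian determinant a
  polynomial.\<close>

lemma poly_map_has_derivative:
  assumes "f \<in> poly_map"
  shows "\<exists>D. (\<forall>i. D i \<in> poly_map) \<and>
    (\<forall>x. (f has_derivative (\<lambda>h. \<Sum>i\<in>UNIV. D i x * h $ i)) (at x))"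
  using assms
proof induction
  case (const a)
  show ?case by (rule exI[of _ "\<lambda>i x. 0"]) (auto intro: poly_map.const)
next
  case (coord k)
  have "bounded_linear (\<lambda>x. x $ k :: complex)" by (rule bounded_linear_vec_nth)
  then have "((\<lambda>x. x $ k :: complex) has_derivative (\<lambda>h. h $ k)) (at x)" for x
    by (rule bounded_linear_imp_has_derivative)
  moreover have "(\<Sum>i\<in>UNIV. (if i = k then 1 else 0) * h $ i) = h $ k" for h :: "complex^'a"
    by (simp add: if_distrib[of "\<lambda>z. z * _"] cong: if_cong)
  ultimately show ?case
    by (intro exI[of _ "\<lambda>i x. if i = k then 1 else 0"]) (auto intro: poly_map.const)
next
  case (add f g)
  then obtain D E where D: "\<forall>i. D i \<in> poly_map"
      "\<And>x. (f has_derivative (\<lambda>h. \<Sum>i\<in>UNIV. D i x * h $ i)) (at x)"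
    and E: "\<forall>i. E i \<in> poly_map"
      "\<And>x. (g has_derivative (\<lambda>h. \<Sum>i\<in>UNIV. E i x * h $ i)) (at x)" by blast
  show ?case
    using D(1) E(1) has_derivative_add[OF D(2) E(2)]
    by (intro exI[of _ "\<lambda>i x. D i x + E i x"])
       (auto intro!: poly_map.intros simp: distrib_right sum.distrib)
next
  case (mult f g)
  then obtain D E where D: "\<forall>i. D i \<in> poly_map"
      "\<And>x. (f has_derivative (\<lambda>h. \<Sum>i\<in>UNIV. D i x * h $ i)) (at x)"
    and E: "\<forall>i. E i \<in> poly_map"
      "\<And>x. (g has_derivative (\<lambda>h. \<Sum>i\<in>UNIV. E i x * h $ i)) (at x)" by blast
  have eq: "(\<Sum>i\<in>UNIV. (f x * E i x + D i x * g x) * h $ i) =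
    f x * (\<Sum>i\<in>UNIV. E i x * h $ i) + (\<Sum>i\<in>UNIV. D i x * h $ i) * g x" for x h
    by (simp add: distrib_right sum_distrib_left sum_distrib_right mult_ac flip: sum.distrib)
       (simp add: algebra_simps)
  show ?case
    using D(1) E(1) has_derivative_mult[OF D(2) E(2)] mult.hyps
    by (intro exI[of _ "\<lambda>i x. f x * E i x + D i x * g x"])
       (auto intro!: poly_map.intros simp: eq)
qed

lemma poly_map_continuous_on: "f \<in> poly_map \<Longrightarrow> continuous_on S f"
  by (induction rule: poly_map.induct) (auto intro!: continuous_intros)

text \<open>Polynomials form an integral domain: on the line from \<open>x\<close> to
  \<open>a\<close> this is the univariate fact, the first factor being nonzero at parameter
  1.\<close>

lemma poly_map_mult_eq_0:
  assumes "f \<in> poly_map" "g \<in> poly_map" "\<And>x. f x * g x = 0" "f a \<noteq> 0"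
  shows "g x = 0"
proof -
  obtain p where p: "\<And>t. f (x + t *s (a - x)) = poly p t"
    using poly_map_line[OF assms(1)] by blast
  obtain q where q: "\<And>t. g (x + t *s (a - x)) = poly q t"
    using poly_map_line[OF assms(2)] by blast
  have "poly (p * q) t = 0" for t
    using assms(3) by (simp flip: p q)
  then have "p * q = 0" using poly_all_0_iff_0 by blast
  moreover have "p \<noteq> 0" using p[of 1] assms(4) by auto
  ultimately have "q = 0" by simp
  then show ?thesis using q[of 0] by simp
qed

lemma poly_map_prod_nonzero:
  assumes "finite I" "\<And>i. i \<in> I \<Longrightarrow> f i \<in> poly_map \<and> (\<exists>x. f i x \<noteq> 0)"
  shows "\<exists>x. (\<Prod>i\<in>I. f i x) \<noteq> 0"
  using assms
proof (induction I rule: finite_induct)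
  case (insert j I)
  then have "(\<lambda>x. \<Prod>i\<in>I. f i x) \<in> poly_map" "\<exists>x. (\<Prod>i\<in>I. f i x) \<noteq> 0"
    by (auto intro!: poly_map_prod)
  with insert poly_map_mult_eq_0[of "f j" "\<lambda>x. \<Prod>i\<in>I. f i x"] show ?case by fastforce
qed auto

text \<open>On the line from \<open>w\<close> to \<open>a\<close> the set \<open>W\<close> cuts out
  a nonempty open, hence infinite, set of parameters, whereas \<open>f\<close> has only finitely
  many zeros there.\<close>

lemma poly_map_nonzero_on_open:
  assumes "f \<in> poly_map" "f a \<noteq> 0" "open W" "w \<in> W"
  shows "\<exists>x\<in>W. f x \<noteq> 0"
proof (rule ccontr)
  assume "\<not> ?thesis"
  then have zero: "\<And>x. x \<in> W \<Longrightarrow> f x = 0" by auto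
  obtain p where p: "\<And>t. f (w + t *s (a - w)) = poly p t"
    using poly_map_line[OF assms(1)] by blast
  have "p \<noteq> 0" using p[of 1] assms(2) by auto
  then have fin: "finite {t. poly p t = 0}" by (rule poly_roots_finite)
  have "continuous_on UNIV (\<lambda>t. w + t *s (a - w))"
    unfolding vector_scalar_mult_def by (intro continuous_intros)
  then have "open ((\<lambda>t. w + t *s (a - w)) -` W)"
    using assms(3) by (simp add: open_vimage)
  moreover have "0 \<in> (\<lambda>t. w + t *s (a - w)) -` W" using assms(4) by simp
  ultimately have "infinite ((\<lambda>t. w + t *s (a - w)) -` W)"
    using finite_imp_not_open by blast
  moreover have "(\<lambda>t. w + t *s (a - w)) -` W \<subseteq> {t. poly p t = 0}"
    using zero by (auto simp flip: p)
  ultimately show False using fin finite_subset by blast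
qed

text \<open>Bounding the degree in each variable separately is all that the counting argument needs: such a
  function is determined by its values on the grid \<open>{0..D}\<^sup>n\<close>.\<close>

definition sep_degree_le :: "nat \<Rightarrow> (complex^'n \<Rightarrow> complex) \<Rightarrow> bool" where
  "sep_degree_le D f \<longleftrightarrow>
    (\<forall>x i. \<exists>p. degree p \<le> D \<and> (\<forall>t. f (\<chi> j. if j = i then t else x $ j) = poly p t))"

lemma sep_degree_le_mono: "sep_degree_le D f \<Longrightarrow> D \<le> E \<Longrightarrow> sep_degree_le E f"
  unfolding sep_degree_le_def by (meson order_trans)

lemma sep_degree_le_const: "sep_degree_le D (\<lambda>x. a)"
  unfolding sep_degree_le_def by (intro allI exI[of _ "[:a:]"]) simp

lemma sep_degree_le_coord: "sep_degree_le 1 (\<lambda>x. x $ k)"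
  unfolding sep_degree_le_def
proof (intro allI)
  fix x :: "complex^'a" and i
  show "\<exists>p. degree p \<le> 1 \<and> (\<forall>t. (\<chi> j. if j = i then t else x $ j) $ k = poly p t)"
    by (rule exI[of _ "if k = i then [:0, 1:] else [:x $ k:]"]) auto
qed

lemma sep_degree_le_add:
  assumes "sep_degree_le D f" "sep_degree_le D g"
  shows "sep_degree_le D (\<lambda>x. f x + g x)"
  unfolding sep_degree_le_def
proof (intro allI)
  fix x i
  obtain p q where "degree p \<le> D" "\<forall>t. f (\<chi> j. if j = i then t else x $ j) = poly p t"
    "degree q \<le> D" "\<forall>t. g (\<chi> j. if j = i then t else x $ j) = poly q t"
    using assms unfolding sep_degree_le_def by metis
  then show "\<exists>p. degree p \<le> D \<and> (\<forall>t. f (\<chi> j. if j = i then t else x $ j) +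
      g (\<chi> j. if j = i then t else x $ j) = poly p t)"
    by (intro exI[of _ "p + q"]) (auto intro: degree_add_le)
qed

lemma sep_degree_le_mult:
  assumes "sep_degree_le D f" "sep_degree_le E g"
  shows "sep_degree_le (D + E) (\<lambda>x. f x * g x)"
  unfolding sep_degree_le_def
proof (intro allI)
  fix x i
  obtain p q where "degree p \<le> D" "\<forall>t. f (\<chi> j. if j = i then t else x $ j) = poly p t"
    "degree q \<le> E" "\<forall>t. g (\<chi> j. if j = i then t else x $ j) = poly q t"
    using assms unfolding sep_degree_le_def by metis
  then show "\<exists>p. degree p \<le> D + E \<and> (\<forall>t. f (\<chi> j. if j = i then t else x $ j) *
      g (\<chi> j. if j = i then t else x $ j) = poly p t)"
    by (intro exI[of _ "p * q"]) (auto intro: order_trans[OF degree_mult_le])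
qed

lemma sep_degree_le_power: "sep_degree_le D f \<Longrightarrow> sep_degree_le (k * D) (\<lambda>x. f x ^ k)"
  by (induction k) (auto intro: sep_degree_le_const sep_degree_le_mult)

lemma sep_degree_le_sum:
  "(\<And>i. i \<in> I \<Longrightarrow> sep_degree_le D (f i)) \<Longrightarrow> sep_degree_le D (\<lambda>x. \<Sum>i\<in>I. f i x)"
  by (induction I rule: infinite_finite_induct)
     (auto intro: sep_degree_le_const sep_degree_le_add)

lemma sep_degree_le_prod:
  "(\<And>i. i \<in> I \<Longrightarrow> sep_degree_le D (f i)) \<Longrightarrow> sep_degree_le (card I * D) (\<lambda>x. \<Prod>i\<in>I. f i x)"
  by (induction I rule: infinite_finite_induct)
     (auto intro: sep_degree_le_const sep_degree_le_mult)

lemma poly_map_sep_degree: "f \<in> poly_map \<Longrightarrow> \<exists>D. sep_degree_le D f"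
proof (induction rule: poly_map.induct)
  case (add f g)
  then obtain D E where "sep_degree_le D f" "sep_degree_le E g" by blast
  then have "sep_degree_le (max D E) f" "sep_degree_le (max D E) g"
    by (auto intro: sep_degree_le_mono)
  then show ?case by (blast intro: sep_degree_le_add)
qed (blast intro: sep_degree_le_const sep_degree_le_coord sep_degree_le_mult)+

text \<open>The coordinates are released from the grid one at a time; \<open>S\<close> holds those
  already free. In each new direction a univariate polynomial of degree at most \<open>D\<close> has
  \<open>D + 1\<close> roots.\<close>

lemma sep_degree_le_eq_0:
  fixes f :: "complex^'n \<Rightarrow> complex"
  assumes f: "sep_degree_le D f"
    and grid: "\<And>x. (\<And>i. x $ i \<in> of_nat ` {..D}) \<Longrightarrow> f x = 0"
  shows "f x = 0"
proof -
  have "\<forall>x. (\<forall>i. i \<notin> S \<longrightarrow> x $ i \<in> of_nat ` {..D}) \<longrightarrow> f x = 0" if "finite S" for S :: "'n set"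
    using that
  proof induction
    case empty
    then show ?case using grid by auto
  next
    case (insert k S)
    show ?case
    proof (intro allI impI)
      fix x :: "complex^'n"
      assume x: "\<forall>i. i \<notin> insert k S \<longrightarrow> x $ i \<in> of_nat ` {..D}"
      obtain p where p: "degree p \<le> D" "\<And>t. f (\<chi> j. if j = k then t else x $ j) = poly p t"
        using f unfolding sep_degree_le_def by blast
      have "poly p t = 0" if "t \<in> of_nat ` {..D}" for t
        unfolding p(2)[symmetric] using x that by (intro insert.IH[rule_format]) auto
      then have "of_nat ` {..D} \<subseteq> {t. poly p t = 0}" by auto
      moreover have "card (of_nat ` {..D} :: complex set) = Suc D"
        by (subst card_image) (auto simp: inj_on_def)
      ultimately have "p = 0"
        using p(1) card_poly_roots_bound[of p] poly_roots_finite[of p]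
        by (metis card_mono not_less_eq_eq order_trans)
      moreover have "(\<chi> j. if j = k then x $ k else x $ j) = x" by (simp add: vec_eq_iff)
      ultimately show "f x = 0" using p(2)[of "x $ k"] by simp
    qed
  qed
  from this[of UNIV] show ?thesis by simp
qed

text \<open>For \<open>m < B ^ n\<close> the base-\<open>B\<close> digits recover \<open>m\<close>,
  which is what turns Kronecker's substitution into \<open>t ^ m\<close>.\<close>

lemma sum_digits: "(\<Sum>i<n. (m div B ^ i) mod B * B ^ i) = m mod B ^ n" for m B :: nat
proof (induction n)
  case (Suc n)
  have "m mod B ^ Suc n = B ^ n * (m div B ^ n mod B) + m mod B ^ n"
    unfolding power_Suc2 by (rule mod_mult2_eq)
  then show ?case using Suc by (simp add: mult.commute)
qed simp

section \<open>Dominant polynomial maps\<close>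

text \<open>The monomials in \<open>F\<close> and \<open>g\<close> with all exponents below \<open>B\<close> number \<open>B\<^bsup>n+1\<^esup>\<close>, but vanishing of a
  linear combination of them amounts to only \<open>O(B\<^sup>n)\<close> linear conditions. The exponent vectors are encoded
  as base-\<open>B\<close> digits, so that substituting \<open>t\<close> to the power \<open>B\<^sup>i\<close> for the \<open>i\<close>-th variable
  (Kronecker's trick) shows that not all the coefficients \<open>P j\<close> vanish identically.\<close>

lemma algebraic_relation:
  fixes F :: "complex^'n \<Rightarrow> complex^'n" and g :: "complex^'n \<Rightarrow> complex"
  assumes F: "\<And>i. (\<lambda>x. F x $ i) \<in> poly_map" and g: "g \<in> poly_map"
  obtains P k where "\<forall>j. P j \<in> poly_map" "\<exists>j<k. \<exists>y. P j y \<noteq> 0"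
    "\<forall>x. (\<Sum>j<k. P j (F x) * g x ^ j) = 0"
proof -
  define n where "n = CARD('n)"
  obtain h :: "'n \<Rightarrow> nat" where h: "bij_betw h UNIV {..<n}"
    unfolding n_def by (metis atLeast0LessThan ex_bij_betw_finite_nat finite)
  obtain dF where dF: "\<And>i. sep_degree_le (dF i) (\<lambda>x. F x $ i)"
    using poly_map_sep_degree[OF F] by metis
  obtain dg where dg: "sep_degree_le dg g" using poly_map_sep_degree[OF g] by blast
  define d where "d = dg + (\<Sum>i\<in>UNIV. dF i)"
  have "dF i \<le> d" for i
    unfolding d_def by (meson finite UNIV_I member_le_sum trans_le_add2 zero_le)
  then have dF: "sep_degree_le d (\<lambda>x. F x $ i)" for i
    using dF sep_degree_le_mono by blast
  have dg: "sep_degree_le d g" using dg by (rule sep_degree_le_mono) (simp add: d_def)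
  \<comment> \<open>\<open>D\<close> bounds the separate degrees of all products
    \<open>A (m, j)\<close>, and \<open>D + 1 \<le> K * B\<close> with \<open>K\<close> independent
    of \<open>B\<close>. The grid thus has at most \<open>K ^ n * B ^ n\<close> points, fewer than
    the \<open>B * B ^ n\<close> products because \<open>B\<close> exceeds
    \<open>K ^ n\<close>.\<close>
  define K where "K = d * (n + 1) + 1"
  define B where "B = K ^ n + 1"
  define D where "D = n * (B * d) + B * d"
  define dig where "dig m i = (m div B ^ h i) mod B" for m i
  have "B > 0" by (simp add: B_def)
  then have dig: "dig m i \<le> B" for m i by (simp add: dig_def less_imp_le)
  define mon where "mon m y = (\<Prod>i\<in>UNIV. y $ i ^ dig m i)" for m and y :: "complex^'n"
  define A where "A = (\<lambda>(m, j) x. mon m (F x) * g x ^ j)"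
  define G where "G = {x :: complex^'n. \<forall>i. x $ i \<in> of_nat ` {..D}}"
  define I where "I = {..<B ^ n} \<times> {..<B}"
  have G_eq: "G = (\<lambda>f. \<chi> i. f i) ` (UNIV \<rightarrow>\<^sub>E of_nat ` {..D})"
  proof
    show "G \<subseteq> (\<lambda>f. \<chi> i. f i) ` (UNIV \<rightarrow>\<^sub>E of_nat ` {..D})"
    proof
      fix x assume "x \<in> G"
      then have "($) x \<in> UNIV \<rightarrow>\<^sub>E of_nat ` {..D}" by (auto simp: G_def)
      then show "x \<in> (\<lambda>f. \<chi> i. f i) ` (UNIV \<rightarrow>\<^sub>E of_nat ` {..D})"
        by (metis image_eqI vec_nth_inverse)
    qed
  qed (auto simp: G_def PiE_iff)
  have fin: "finite (UNIV \<rightarrow>\<^sub>E of_nat ` {..D} :: ('n \<Rightarrow> complex) set)"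
    by (intro finite_PiE) auto
  then have finG: "finite G" unfolding G_eq by simp
  have "card G \<le> card (UNIV \<rightarrow>\<^sub>E of_nat ` {..D} :: ('n \<Rightarrow> complex) set)"
    unfolding G_eq using fin by (rule card_image_le)
  also have "\<dots> = (card (of_nat ` {..D} :: complex set)) ^ n"
    by (simp add: card_PiE n_def)
  also have "card (of_nat ` {..D} :: complex set) = D + 1"
    by (subst card_image) (auto simp: inj_on_def)
  also have "D + 1 \<le> K * B" using \<open>B > 0\<close> by (simp add: D_def K_def algebra_simps)
  then have "(D + 1) ^ n \<le> K ^ n * B ^ n" by (metis power_mono power_mult_distrib zero_le)
  also have "\<dots> < B * B ^ n" using \<open>B > 0\<close> by (simp add: B_def)
  also have "\<dots> = card I" by (simp add: I_def)
  finally have "card G < card I" .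
  \<comment> \<open>One equation for each grid point, one unknown for each product.\<close>
  from underdetermined_system[OF finG _ this, of A] obtain c where
    c: "\<exists>i\<in>I. c i \<noteq> 0" "\<And>x. x \<in> G \<Longrightarrow> (\<Sum>i\<in>I. c i * A i x) = 0"
    by (auto simp: I_def)
  have "sep_degree_le D (A i)" if "i \<in> I" for i
  proof -
    obtain m j where i: "i = (m, j)" "j < B" using \<open>i \<in> I\<close> by (auto simp: I_def)
    have "sep_degree_le (dig m k * d) (\<lambda>x. F x $ k ^ dig m k)" for k
      using dF by (rule sep_degree_le_power)
    then have "sep_degree_le (B * d) (\<lambda>x. F x $ k ^ dig m k)" for k
      by (rule sep_degree_le_mono) (simp add: dig)
    then have "sep_degree_le (card (UNIV :: 'n set) * (B * d)) (\<lambda>x. mon m (F x))"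
      unfolding mon_def by (rule sep_degree_le_prod)
    moreover have "sep_degree_le (B * d) (\<lambda>x. g x ^ j)"
      using sep_degree_le_power[OF dg] by (rule sep_degree_le_mono) (use i in simp)
    ultimately show ?thesis unfolding A_def D_def n_def i prod.case by (rule sep_degree_le_mult)
  qed
  then have "sep_degree_le D (\<lambda>x. c i * A i x)" if "i \<in> I" for i
    using sep_degree_le_mult[OF sep_degree_le_const[of 0]] that by fastforce
  then have "sep_degree_le D (\<lambda>x. \<Sum>i\<in>I. c i * A i x)" by (rule sep_degree_le_sum)
  then have zero: "(\<Sum>i\<in>I. c i * A i x) = 0" for x
    using c(2) by (rule sep_degree_le_eq_0) (simp add: G_def)
  define P where "P j y = (\<Sum>m<B ^ n. c (m, j) * mon m y)" for j y
  have "P j \<in> poly_map" for j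
    unfolding P_def mon_def
    by (intro poly_map_sum poly_map.mult poly_map.const poly_map_prod poly_map_power poly_map.coord)
  moreover have "(\<Sum>j<B. P j (F x) * g x ^ j) = 0" for x
  proof -
    have "(\<Sum>j<B. P j (F x) * g x ^ j) = (\<Sum>j<B. \<Sum>m<B ^ n. c (m, j) * A (m, j) x)"
      by (simp add: P_def A_def sum_distrib_right mult.assoc)
    also have "\<dots> = (\<Sum>m<B ^ n. \<Sum>j<B. c (m, j) * A (m, j) x)" by (rule sum.swap)
    also have "\<dots> = (\<Sum>i\<in>I. c i * A i x)"
      by (simp add: I_def sum.cartesian_product case_prod_unfold)
    finally show ?thesis using zero by simp
  qed
  moreover have "\<exists>j<B. \<exists>y. P j y \<noteq> 0"
  proof (rule ccontr)
    assume "\<not> ?thesis"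
    then have P0: "P j y = 0" if "j < B" for j y using that by blast
    obtain m j where mj: "m < B ^ n" "j < B" "c (m, j) \<noteq> 0"
      using c(1) by (auto simp: I_def)
    have mon: "mon l (\<chi> i. t ^ (B ^ h i)) = t ^ l" if "l < B ^ n" for l and t :: complex
    proof -
      have "mon l (\<chi> i. t ^ (B ^ h i)) = t ^ (\<Sum>i\<in>UNIV. dig l i * B ^ h i)"
        by (simp add: mon_def power_sum mult.commute flip: power_mult)
      also have "(\<Sum>i\<in>UNIV. dig l i * B ^ h i) = (\<Sum>k<n. (l div B ^ k) mod B * B ^ k)"
        unfolding dig_def by (rule sum.reindex_bij_betw[OF h])
      also have "\<dots> = l" using that by (simp add: sum_digits)
      finally show ?thesis .
    qed
    define p where "p = (\<Sum>l<B ^ n. monom (c (l, j)) l)"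
    have "poly p t = P j (\<chi> i. t ^ (B ^ h i))" for t
      by (simp add: p_def P_def poly_sum poly_monom mon)
    then have "p = 0" using P0[OF mj(2)] poly_all_0_iff_0 by metis
    moreover have "coeff p m = c (m, j)"
      using mj(1) by (simp add: p_def coeff_sum if_distrib cong: if_cong)
    ultimately show False using mj(3) by simp
  qed
  ultimately show ?thesis using that by blast
qed

section \<open>Growth and zeros of a polynomial in terms of the values of \<open>F\<close>\<close>

text \<open>Outside the unit disc every lower power of \<open>z\<close> is at most
  \<open>norm z ^ (m - 1)\<close> in norm, so the leading term can only be cancelled if
  \<open>norm z\<close> is at most the quotient. The summand 1 covers the unit disc.\<close>

lemma root_bound:
  fixes p :: "nat \<Rightarrow> 'a::real_normed_field"
  assumes "(\<Sum>j<Suc m. p j * z ^ j) = 0" "p m \<noteq> 0"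
  shows "norm z \<le> 1 + (\<Sum>j<m. norm (p j)) / norm (p m)"
proof (cases "norm z \<le> 1")
  case True
  then show ?thesis by (simp add: add_increasing2 sum_nonneg)
next
  case False
  then have z: "norm z > 1" by simp
  show ?thesis
  proof (cases m)
    case 0
    then show ?thesis using assms by simp
  next
    case (Suc l)
    have "p m * z ^ m = - (\<Sum>j<m. p j * z ^ j)"
      using assms(1) by (simp add: eq_neg_iff_add_eq_0 add.commute)
    then have "norm (p m) * norm z ^ m = norm (\<Sum>j<m. p j * z ^ j)"
      by (metis norm_minus_cancel norm_mult norm_power)
    also have "\<dots> \<le> (\<Sum>j<m. norm (p j) * norm z ^ l)"
    proof (rule sum_norm_le)
      fix j assume "j \<in> {..<m}"
      then have "norm z ^ j \<le> norm z ^ l"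
        using z Suc by (intro power_increasing) auto
      then show "norm (p j * z ^ j) \<le> norm (p j) * norm z ^ l"
        by (simp add: norm_mult norm_power mult_left_mono)
    qed
    also have "\<dots> = (\<Sum>j<m. norm (p j)) * norm z ^ l" by (simp add: sum_distrib_right)
    finally have "norm (p m) * norm z * norm z ^ l \<le> (\<Sum>j<m. norm (p j)) * norm z ^ l"
      by (simp add: Suc mult.assoc)
    then have "norm (p m) * norm z \<le> (\<Sum>j<m. norm (p j))"
      by (rule mult_right_le_imp_le) (use z in \<open>auto intro!: zero_less_power intro: less_trans[OF zero_less_one]\<close>)
    then have "norm z \<le> (\<Sum>j<m. norm (p j)) / norm (p m)"
      using assms(2) by (simp add: field_simps)
    then show ?thesis by simp
  qed
qed

text \<open>The leading coefficient of an algebraic relation for \<open>g\<close> over \<open>F\<close> controls the growth of \<open>g\<close>;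
  the lowest coefficient, used in the next lemma, controls its zeros.\<close>

lemma poly_map_locally_bounded:
  fixes F :: "complex^'n \<Rightarrow> complex^'n" and g :: "complex^'n \<Rightarrow> complex"
  assumes F: "\<And>i. (\<lambda>x. F x $ i) \<in> poly_map" and g: "g \<in> poly_map"
  shows "\<exists>a. a \<in> poly_map \<and> (\<exists>y. a y \<noteq> 0) \<and>
    (\<forall>y. a y \<noteq> 0 \<longrightarrow> (\<exists>W M. open W \<and> y \<in> W \<and> (\<forall>x. F x \<in> W \<longrightarrow> norm (g x) \<le> M)))"
proof -
  obtain P k where "\<forall>j. P j \<in> poly_map" "\<exists>j<k. \<exists>y. P j y \<noteq> 0"
    "\<forall>x. (\<Sum>j<k. P j (F x) * g x ^ j) = 0"
    by (rule algebraic_relation[OF F g])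
  note P = this(1)[rule_format] this(2) this(3)[rule_format]
  \<comment> \<open>The highest index whose coefficient is not identically zero; the terms above it
    drop out of the relation.\<close>
  define m where "m = (GREATEST j. j < k \<and> (\<exists>y. P j y \<noteq> 0))"
  have m: "m < k \<and> (\<exists>y. P m y \<noteq> 0)"
    unfolding m_def using P(2)
    by (intro GreatestI_ex_nat[of "\<lambda>j. j < k \<and> (\<exists>y. P j y \<noteq> 0)" k]) auto
  have "P j y = 0" if "m < j" "j < k" for j y
    using Greatest_le_nat[of "\<lambda>j. j < k \<and> (\<exists>y. P j y \<noteq> 0)" j k] that by (force simp: m_def)
  then have "(\<Sum>j<k. P j (F x) * g x ^ j) = (\<Sum>j<Suc m. P j (F x) * g x ^ j)" for x
    using m by (intro sum.mono_neutral_right) auto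
  then have rel: "(\<Sum>j<Suc m. P j (F x) * g x ^ j) = 0" for x using P(3) by simp
  \<comment> \<open>The root bound depends on \<open>x\<close> only through \<open>F x\<close>. It
    is continuous where \<open>P m\<close> is nonzero, so near \<open>y\<close> it stays below
    \<open>b y + 1\<close>.\<close>
  define b where "b y = 1 + (\<Sum>j<m. norm (P j y)) / norm (P m y)" for y
  have "\<exists>W M. open W \<and> y \<in> W \<and> (\<forall>x. F x \<in> W \<longrightarrow> norm (g x) \<le> M)" if y: "P m y \<noteq> 0" for y
  proof -
    define U where "U = {y. P m y \<noteq> 0}"
    have cont: "continuous_on U (P j)" for j using P(1) by (rule poly_map_continuous_on)
    have "open U"
      unfolding U_def using poly_map_continuous_on[OF P(1)]
      by (intro open_Collect_neq continuous_on_const)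
    have "continuous_on U b"
      unfolding b_def by (intro continuous_intros cont) (auto simp: U_def)
    then have "open (U \<inter> b -` {..<b y + 1})"
      using \<open>open U\<close> by (intro continuous_open_preimage) auto
    moreover have "norm (g x) \<le> b y + 1" if "F x \<in> U \<inter> b -` {..<b y + 1}" for x
      using root_bound[OF rel, of x] that unfolding U_def b_def by force
    ultimately show ?thesis
      using y by (intro exI[of _ "U \<inter> b -` {..<b y + 1}"] exI[of _ "b y + 1"]) (auto simp: U_def)
  qed
  then show ?thesis using P(1) m by (intro exI[of _ "P m"]) blast
qed

lemma poly_map_nonvanishing:
  fixes F :: "complex^'n \<Rightarrow> complex^'n" and g :: "complex^'n \<Rightarrow> complex"
  assumes F: "\<And>i. (\<lambda>x. F x $ i) \<in> poly_map" and g: "g \<in> poly_map" "g x0 \<noteq> 0"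
  obtains b where "b \<in> poly_map" "\<exists>y. b y \<noteq> 0" "\<forall>x. b (F x) \<noteq> 0 \<longrightarrow> g x \<noteq> 0"
proof -
  obtain P k where "\<forall>j. P j \<in> poly_map" "\<exists>j<k. \<exists>y. P j y \<noteq> 0"
    "\<forall>x. (\<Sum>j<k. P j (F x) * g x ^ j) = 0"
    by (rule algebraic_relation[OF F g(1)])
  note P = this(1)[rule_format] this(2) this(3)[rule_format]
  define m where "m = (LEAST j. \<exists>y. P j y \<noteq> 0)"
  have m: "\<exists>y. P m y \<noteq> 0" unfolding m_def using P(2) LeastI_ex[of "\<lambda>j. \<exists>y. P j y \<noteq> 0"] by blast
  obtain j where "j < k" "\<exists>y. P j y \<noteq> 0" using P(2) by blast
  from this(1) Least_le[of "\<lambda>j. \<exists>y. P j y \<noteq> 0", OF this(2)] have "m < k"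
    unfolding m_def by linarith
  have low: "P j y = 0" if "j < m" for j y
    using not_less_Least[OF that[unfolded m_def]] by simp
  \<comment> \<open>The relation with the factor \<open>g x ^ m\<close> divided out. It still
    vanishes identically, as \<open>g\<close> is not the zero function, and at a zero of
    \<open>g\<close> only its constant term \<open>P m (F x)\<close> remains.\<close>
  define r where "r x = (\<Sum>j<k - m. P (m + j) (F x) * g x ^ j)" for x
  have r_poly: "r \<in> poly_map"
    unfolding r_def
    by (intro poly_map_sum poly_map.mult poly_map_power g(1) poly_map_compose[OF P(1) F])
  have "g x ^ m * r x = 0" for x
  proof -
    have "g x ^ m * r x = (\<Sum>j<k - m. P (m + j) (F x) * g x ^ (m + j))"
      by (simp add: r_def sum_distrib_left power_add mult_ac)
    also have "\<dots> = (\<Sum>j\<in>{m..<k}. P j (F x) * g x ^ j)"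
      using \<open>m < k\<close>
      by (intro sum.reindex_bij_witness[of _ "\<lambda>j. j - m" "\<lambda>j. m + j"]) auto
    also have "\<dots> = (\<Sum>j<k. P j (F x) * g x ^ j)"
      by (rule sum.mono_neutral_left) (auto simp: low not_le)
    finally show ?thesis using P(3) by simp
  qed
  then have r0: "r x = 0" for x
    using poly_map_mult_eq_0[of "\<lambda>x. g x ^ m" r x0] poly_map_power[OF g(1)] r_poly g(2) by simp
  have "g x \<noteq> 0" if "P m (F x) \<noteq> 0" for x
  proof
    assume "g x = 0"
    then have "r x = P m (F x)"
      using \<open>m < k\<close> by (simp add: r_def power_0_left if_distrib cong: if_cong)
    then show False using r0 that by simp
  qed
  then show ?thesis using that[of "P m"] P(1) m by blast
qed

section \<open>The image of a polynomial map with an injective derivative at some point\<close>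

lemma has_derivative_vec_componentwise:
  fixes f :: "'a::euclidean_space \<Rightarrow> 'b::euclidean_space^'n"
  assumes "\<And>i. ((\<lambda>x. f x $ i) has_derivative (\<lambda>h. f' h $ i)) (at x within S)"
  shows "(f has_derivative f') (at x within S)"
  unfolding has_derivative_componentwise_within[of f]
  by (auto simp: Basis_vec_def inner_axis intro: has_derivative_inner_left assms)

theorem poly_map_image_contains_nonvanishing_locus:
  fixes F :: "complex^'n \<Rightarrow> complex^'n"
  assumes F: "\<And>i. (\<lambda>x. F x $ i) \<in> poly_map"
    and der: "(F has_derivative F') (at x0)" and inj: "\<And>h. F' h = 0 \<Longrightarrow> h = 0"
  obtains c where "c \<in> poly_map" "\<exists>y. c y \<noteq> 0" "\<forall>y. c y \<noteq> 0 \<longrightarrow> y \<in> range F"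
proof -
  obtain D where D: "\<And>i j. D i j \<in> poly_map"
    "\<And>i x. ((\<lambda>x. F x $ i) has_derivative (\<lambda>h. \<Sum>j\<in>UNIV. D i j x * h $ j)) (at x)"
  proof -
    have "\<forall>i. \<exists>D. (\<forall>j. D j \<in> poly_map) \<and>
      (\<forall>x. ((\<lambda>x. F x $ i) has_derivative (\<lambda>h. \<Sum>j\<in>UNIV. D j x * h $ j)) (at x))"
      using poly_map_has_derivative[OF F] by blast
    from choice[OF this] show ?thesis using that by blast
  qed
  define A where "A x = (\<chi> i j. D i j x)" for x
  have A: "(F has_derivative (\<lambda>h. A x *v h)) (at x)" for x
    using D(2) by (intro has_derivative_vec_componentwise) (simp add: A_def matrix_vector_mult_def)
  have contF: "continuous_on S F" for S
    using A by (meson has_derivative_continuous continuous_at_imp_continuous_on)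
  define J where "J x = det (A x)" for x
  have J: "J \<in> poly_map" unfolding J_def A_def by (intro poly_map_det D(1))
  \<comment> \<open>At a regular point the inverse of the Jacobian matrix supplies the right inverse
    of the derivative that the open mapping theorem asks for.\<close>
  have open_at: "F x \<in> interior (range F)" if Jx: "J x \<noteq> 0" for x
  proof -
    obtain B where "A x ** B = mat 1"
      using Jx invertible_det_nz[of "A x"] unfolding J_def invertible_def by blast
    then have "(\<lambda>h. A x *v h) \<circ> (\<lambda>h. B *v h) = id"
      by (simp add: fun_eq_iff matrix_vector_mul_assoc)
    moreover have "bounded_linear (\<lambda>h. B *v h)"
      by (rule linear_conv_bounded_linear[THEN iffD1])
         (auto intro!: linearI simp: vec_eq_iff matrix_vector_mult_def scaleR_sum_right
            distrib_left sum.distrib)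
    ultimately show ?thesis
      using sussmann_open_mapping[OF open_UNIV contF UNIV_I A, where g' = "\<lambda>h. B *v h" and T = UNIV] by simp
  qed
  \<comment> \<open>Derivatives are unique, so the injective \<open>F'\<close> is the Jacobian
    matrix at \<open>x0\<close>; hence \<open>J\<close> is not identically zero.\<close>
  have "F' = (\<lambda>h. A x0 *v h)" using has_derivative_unique[OF der A] .
  then have "inj ((*v) (A x0))"
    using inj by (auto simp: inj_def) (metis eq_iff_diff_eq_0 matrix_vector_mult_diff_distrib)
  then have "J x0 \<noteq> 0"
    unfolding J_def using matrix_left_invertible_injective invertible_left_inverse invertible_det_nz
    by metis
  obtain b where b: "b \<in> poly_map" "\<exists>y. b y \<noteq> 0" "\<forall>x. b (F x) \<noteq> 0 \<longrightarrow> J x \<noteq> 0"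
    by (rule poly_map_nonvanishing[OF F J \<open>J x0 \<noteq> 0\<close>])
  have "\<forall>i. \<exists>a. a \<in> poly_map \<and> (\<exists>y. a y \<noteq> 0) \<and>
    (\<forall>y. a y \<noteq> 0 \<longrightarrow> (\<exists>W M. open W \<and> y \<in> W \<and> (\<forall>x. F x \<in> W \<longrightarrow> norm (x $ i) \<le> M)))"
    by (intro allI poly_map_locally_bounded F poly_map.coord)
  from choice[OF this] obtain a where a: "\<And>i. a i \<in> poly_map" "\<And>i. \<exists>y. a i y \<noteq> 0"
    "\<And>i y. a i y \<noteq> 0 \<Longrightarrow> \<exists>W M. open W \<and> y \<in> W \<and> (\<forall>x. F x \<in> W \<longrightarrow> norm (x $ i) \<le> M)"
    by blast
  \<comment> \<open>The factor \<open>b\<close> excludes critical values; the factors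
    \<open>a i\<close> bound the coordinates of all preimages near \<open>y\<close>.\<close>
  define c where "c y = b y * (\<Prod>i\<in>UNIV. a i y)" for y
  have c_poly: "c \<in> poly_map" unfolding c_def by (intro poly_map.mult b(1) poly_map_prod a(1))
  have prod_a: "\<exists>y. (\<Prod>i\<in>UNIV. a i y) \<noteq> 0"
    by (rule poly_map_prod_nonzero) (use a in auto)
  have c_nz: "\<exists>y. c y \<noteq> 0"
    unfolding c_def using b(1,2) prod_a poly_map_mult_eq_0[of b "\<lambda>y. \<Prod>i\<in>UNIV. a i y"]
      poly_map_prod[of UNIV a] a(1) by blast
  \<comment> \<open>Properness near \<open>y\<close>: the preimages of a neighbourhood
    \<open>V\<close> lie in one ball, whose image \<open>C\<close> is compact and so contains every
    limit of points of \<open>V \<inter> range F\<close>.\<close>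
  have closed: "y \<in> range F" if y: "c y \<noteq> 0" "y \<in> closure (range F)" for y
  proof -
    have "\<forall>i. \<exists>W. open W \<and> y \<in> W \<and> (\<exists>M. \<forall>x. F x \<in> W \<longrightarrow> norm (x $ i) \<le> M)"
    proof
      fix i
      have "a i y \<noteq> 0" using y(1) by (auto simp: c_def)
      from a(3)[OF this]
      show "\<exists>W. open W \<and> y \<in> W \<and> (\<exists>M. \<forall>x. F x \<in> W \<longrightarrow> norm (x $ i) \<le> M)" by simp
    qed
    from choice[OF this] obtain W where
      W': "\<forall>i. open (W i) \<and> y \<in> W i \<and> (\<exists>M. \<forall>x. F x \<in> W i \<longrightarrow> norm (x $ i) \<le> M)" ..
    then have W: "open (W i)" "y \<in> W i" for i by simp_all
    have "\<forall>i. \<exists>M. \<forall>x. F x \<in> W i \<longrightarrow> norm (x $ i) \<le> M" using W' by simp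
    from choice[OF this] obtain M where
      M: "\<forall>i x. F x \<in> W i \<longrightarrow> norm (x $ i) \<le> M i" ..
    define V where "V = (\<Inter>i. W i)"
    have "open V" "y \<in> V" using W by (auto simp: V_def)
    define C where "C = F ` cball 0 (\<Sum>i\<in>UNIV. M i)"
    have "compact C" unfolding C_def using contF by (intro compact_continuous_image) auto
    have sub: "V \<inter> range F \<subseteq> C"
    proof
      fix z assume "z \<in> V \<inter> range F"
      then obtain x where x: "z = F x" "F x \<in> V" by auto
      have "norm x \<le> (\<Sum>i\<in>UNIV. norm (x $ i))"
        unfolding norm_vec_def by (rule L2_set_le_sum) simp
      also have "\<dots> \<le> (\<Sum>i\<in>UNIV. M i)"
        by (rule sum_mono) (use x M in \<open>auto simp: V_def\<close>)
      finally show "z \<in> C" using x by (auto simp: C_def)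
    qed
    have "y \<in> closure (V \<inter> range F)"
      using open_Int_closure_subset[OF \<open>open V\<close>, of "range F"] \<open>y \<in> V\<close> y(2) by blast
    also have "\<dots> \<subseteq> C"
      using sub \<open>compact C\<close> by (intro closure_minimal compact_imp_closed)
    finally show ?thesis by (auto simp: C_def)
  qed
  have opn: "y \<in> interior (range F)" if "c y \<noteq> 0" "y \<in> range F" for y
    using that b(3) open_at by (auto simp: c_def)
  \<comment> \<open>The range has interior because \<open>x0\<close> is a regular point, and
    \<open>c\<close> cannot vanish on all of a nonempty open set.\<close>
  obtain y0 where y0: "y0 \<in> range F" "c y0 \<noteq> 0"
  proof -
    obtain y where "c y \<noteq> 0" using c_nz by blast
    from poly_map_nonzero_on_open[OF c_poly this open_interior open_at[OF \<open>J x0 \<noteq> 0\<close>]]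
    show ?thesis using that interior_subset by blast
  qed
  have "y1 \<in> range F" if y1: "c y1 \<noteq> 0" for y1
  proof -
    define u where "u t = y0 + t *s (y1 - y0)" for t
    have contu: "continuous_on S u" for S
      unfolding u_def vector_scalar_mult_def by (intro continuous_intros)
    obtain p where p: "\<And>t. c (u t) = poly p t"
      unfolding u_def using poly_map_line[OF c_poly] by blast
    \<comment> \<open>The plane of parameters minus finitely many points is connected. Within it,
      the parameters \<open>S\<close> that land in the range are both open and closed, and 0 is
      among them; so 1 is as well.\<close>
    define T where "T = - {t. poly p t = 0}"
    have "p \<noteq> 0" using p[of 0] y0(2) by (auto simp: u_def)
    then have "connected T"
      unfolding T_def
      by (intro path_connected_imp_connected path_connected_complement_countable
           countable_finite poly_roots_finite) auto
    define S where "S = T \<inter> u -` range F"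
    have cT: "c (u t) \<noteq> 0" if "t \<in> T" for t using that by (simp add: p T_def)
    have "S = T \<inter> u -` interior (range F)"
      using opn cT interior_subset[of "range F"] by (fastforce simp: S_def)
    then have "openin (top_of_set T) S"
      using continuous_openin_preimage_gen[OF contu open_interior] by metis
    moreover have "S = T \<inter> u -` closure (range F)"
      using closed cT closure_subset[of "range F"] by (fastforce simp: S_def)
    then have "closedin (top_of_set T) S"
      using continuous_closedin_preimage[OF contu closed_closure] by metis
    moreover have "0 \<in> S"
      using y0 p[of 0] by (auto simp: S_def T_def u_def)
    ultimately have "S = T" using \<open>connected T\<close> unfolding connected_clopen by blast
    moreover have "1 \<in> T" using y1 p[of 1] by (auto simp: T_def u_def)
    ultimately have "u 1 \<in> range F" by (auto simp: S_def)
    then show ?thesis by (simp add: u_def)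
  qed
  then show ?thesis using that c_poly c_nz by blast
qed

section \<open>Ternary quartics\<close>

text \<open>The fifteen quartic monomials, a most frequent letter first: \<open>YYYX\<close> is y^3
  x and \<open>ZZXY\<close> is x y z^2. As an index type it gives source and target of the
  coefficient map the same dimension.\<close>

datatype ix = XXXX | XXXY | XXXZ | YYYX | YYYY | YYYZ | ZZZX | ZZZY | ZZZZ
  | XXYY | XXZZ | YYZZ | XXYZ | YYXZ | ZZXY

lemma UNIV_ix: "UNIV = {XXXX, XXXY, XXXZ, YYYX, YYYY, YYYZ, ZZZX, ZZZY, ZZZZ,
    XXYY, XXZZ, YYZZ, XXYZ, YYXZ, ZZXY}"
  using ix.exhaust by blast

instance ix :: finite
  by standard (simp add: UNIV_ix)

definition expo :: "nat \<Rightarrow> nat \<Rightarrow> nat \<Rightarrow> nat \<Rightarrow> nat" where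
  "expo a b c i = (if i = 0 then a else if i = 1 then b else if i = 2 then c else 0)"

lemma expo_eq_iff [simp]: "expo a b c = expo a' b' c' \<longleftrightarrow> a = a' \<and> b = b' \<and> c = c'"
proof
  assume "expo a b c = expo a' b' c'"
  then have "expo a b c i = expo a' b' c' i" for i by simp
  from this[of 0] this[of 1] this[of 2] show "a = a' \<and> b = b' \<and> c = c'" by (simp add: expo_def)
qed simp

text \<open>The first two exponents determine the third, and \<open>b \<le> d - a\<close> keeps the
  natural-number subtraction exact.\<close>

lemma monomials_3:
  "monomials 3 d = (\<lambda>(a, b). expo a b (d - a - b)) ` (SIGMA a:{..d}. {..d - a})"
proof (intro equalityI subsetI)
  fix \<alpha> assume \<alpha>: "\<alpha> \<in> monomials 3 d"
  then have d: "\<alpha> 0 + \<alpha> 1 + \<alpha> 2 = d"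
    by (simp add: monomials_def numeral_3_eq_3 numeral_2_eq_2)
  moreover have "\<alpha> = expo (\<alpha> 0) (\<alpha> 1) (\<alpha> 2)"
  proof
    fix i :: nat
    have "i = 0 \<or> i = 1 \<or> i = 2 \<or> i \<ge> 3" by arith
    then show "\<alpha> i = expo (\<alpha> 0) (\<alpha> 1) (\<alpha> 2) i" using \<alpha> by (auto simp: expo_def monomials_def)
  qed
  ultimately show "\<alpha> \<in> (\<lambda>(a, b). expo a b (d - a - b)) ` (SIGMA a:{..d}. {..d - a})"
    by (intro image_eqI[of _ _ "(\<alpha> 0, \<alpha> 1)"]) auto
qed (auto simp: monomials_def expo_def numeral_3_eq_3)

lemma peval_3: "peval 3 d c x =
  (\<Sum>a\<le>d. \<Sum>b\<le>d - a. c (expo a b (d - a - b)) * (x 0 ^ a * x 1 ^ b * x 2 ^ (d - a - b)))"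
proof -
  have "inj_on (\<lambda>(a, b). expo a b (d - a - b)) (SIGMA a:{..d}. {..d - a})"
    by (auto simp: inj_on_def)
  then have "peval 3 d c x = (\<Sum>(a, b)\<in>(SIGMA a:{..d}. {..d - a}).
      c (expo a b (d - a - b)) * (\<Prod>i<3. x i ^ expo a b (d - a - b) i))"
    unfolding peval_def monomials_3 by (simp add: sum.reindex case_prod_unfold)
  also have "\<dots> = (\<Sum>a\<le>d. \<Sum>b\<le>d - a. c (expo a b (d - a - b)) * (\<Prod>i<3. x i ^ expo a b (d - a - b) i))"
    by (simp add: sum.Sigma)
  finally show ?thesis by (simp add: numeral_3_eq_3 expo_def numeral_2_eq_2 mult.assoc)
qed

lemma peval_3_1: "peval 3 1 c x =
  c (expo 1 0 0) * x 0 + c (expo 0 1 0) * x 1 + c (expo 0 0 1) * x 2"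
  by (simp add: peval_3 algebra_simps)

lemma peval_3_2: "peval 3 2 c x =
  c (expo 2 0 0) * x 0 ^ 2 + c (expo 0 2 0) * x 1 ^ 2 + c (expo 0 0 2) * x 2 ^ 2
  + c (expo 1 1 0) * (x 0 * x 1) + c (expo 1 0 1) * (x 0 * x 2) + c (expo 0 1 1) * (x 1 * x 2)"
proof -
  have "{..2::nat} = {0,1,2}" "{..1::nat} = {0,1}" by auto
  then show ?thesis by (simp add: peval_3 algebra_simps)
qed

fun ix_expo :: "ix \<Rightarrow> nat \<Rightarrow> nat" where
  "ix_expo XXXX = expo 4 0 0"
| "ix_expo XXXY = expo 3 1 0"
| "ix_expo XXXZ = expo 3 0 1"
| "ix_expo YYYX = expo 1 3 0"
| "ix_expo YYYY = expo 0 4 0"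
| "ix_expo YYYZ = expo 0 3 1"
| "ix_expo ZZZX = expo 1 0 3"
| "ix_expo ZZZY = expo 0 1 3"
| "ix_expo ZZZZ = expo 0 0 4"
| "ix_expo XXYY = expo 2 2 0"
| "ix_expo XXZZ = expo 2 0 2"
| "ix_expo YYZZ = expo 0 2 2"
| "ix_expo XXYZ = expo 2 1 1"
| "ix_expo YYXZ = expo 1 2 1"
| "ix_expo ZZXY = expo 1 1 2"

lemma inj_ix_expo: "inj ix_expo"
proof (rule injI)
  fix i j assume "ix_expo i = ix_expo j"
  then show "i = j" by (cases i; cases j; simp)
qed

lemma ix_expo_monomial: "ix_expo i \<in> monomials 3 4"
  by (cases i) (auto simp: monomials_def expo_def numeral_3_eq_3)

lemma peval_3_4: "peval 3 4 c x =
   c (ix_expo XXXX) * x 0 ^ 4 + c (ix_expo XXXY) * (x 0 ^ 3 * x 1) + c (ix_expo XXXZ) * (x 0 ^ 3 * x 2)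
 + c (ix_expo YYYX) * (x 1 ^ 3 * x 0) + c (ix_expo YYYY) * x 1 ^ 4 + c (ix_expo YYYZ) * (x 1 ^ 3 * x 2)
 + c (ix_expo ZZZX) * (x 2 ^ 3 * x 0) + c (ix_expo ZZZY) * (x 2 ^ 3 * x 1) + c (ix_expo ZZZZ) * x 2 ^ 4
 + c (ix_expo XXYY) * (x 0 ^ 2 * x 1 ^ 2) + c (ix_expo XXZZ) * (x 0 ^ 2 * x 2 ^ 2)
 + c (ix_expo YYZZ) * (x 1 ^ 2 * x 2 ^ 2) + c (ix_expo XXYZ) * (x 0 ^ 2 * x 1 * x 2)
 + c (ix_expo YYXZ) * (x 0 * x 1 ^ 2 * x 2) + c (ix_expo ZZXY) * (x 0 * x 1 * x 2 ^ 2)"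
proof -
  have "{..4::nat} = {0,1,2,3,4}" "{..3::nat} = {0,1,2,3}" "{..2::nat} = {0,1,2}" by auto
  then show ?thesis by (simp add: peval_3 algebra_simps)
qed

text \<open>The source coordinates of \<open>quartic_map\<close> are labelled by the quartic monomials as well:
  \<open>XXXY\<close> is the coefficient of \<open>y\<close> in the linear form attached to \<open>x\<close>, and similarly for the other
  eight monomials divisible by a cube; the remaining six label the coefficients of \<open>q\<close>.\<close>

definition quad_of :: "complex^ix \<Rightarrow> (nat \<Rightarrow> nat) \<Rightarrow> complex" where
  "quad_of v = (\<lambda>\<alpha>. 0)(expo 2 0 0 := v $ XXYZ, expo 0 2 0 := v $ YYXZ, expo 0 0 2 := v $ ZZXY,
     expo 1 1 0 := v $ XXYY, expo 1 0 1 := v $ XXZZ, expo 0 1 1 := v $ YYZZ)"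

definition lin_of :: "complex \<Rightarrow> complex \<Rightarrow> complex \<Rightarrow> (nat \<Rightarrow> nat) \<Rightarrow> complex" where
  "lin_of a b c = (\<lambda>\<alpha>. 0)(expo 1 0 0 := a, expo 0 1 0 := b, expo 0 0 1 := c)"

lemma quad_of_H: "quad_of v \<in> H 2 3"
  by (auto simp: H_def quad_of_def monomials_def expo_def numeral_3_eq_3)

lemma lin_of_H: "lin_of a b c \<in> H 1 3"
  by (auto simp: H_def lin_of_def monomials_def expo_def numeral_3_eq_3)

text \<open>The coefficients of q^2 + l1^4 + l2^4 + l3^4; the factors 4, 6 and 12 are the
  multinomial coefficients of a fourth power.\<close>

fun quartic_coeff :: "complex^ix \<Rightarrow> ix \<Rightarrow> complex" where
  "quartic_coeff v XXXX = v$XXYZ ^ 2 + v$XXXX ^ 4 + v$YYYX ^ 4 + v$ZZZX ^ 4"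
| "quartic_coeff v YYYY = v$YYXZ ^ 2 + v$XXXY ^ 4 + v$YYYY ^ 4 + v$ZZZY ^ 4"
| "quartic_coeff v ZZZZ = v$ZZXY ^ 2 + v$XXXZ ^ 4 + v$YYYZ ^ 4 + v$ZZZZ ^ 4"
| "quartic_coeff v XXXY = 2 * v$XXYZ * v$XXYY
     + 4 * (v$XXXX ^ 3 * v$XXXY + v$YYYX ^ 3 * v$YYYY + v$ZZZX ^ 3 * v$ZZZY)"
| "quartic_coeff v XXXZ = 2 * v$XXYZ * v$XXZZ
     + 4 * (v$XXXX ^ 3 * v$XXXZ + v$YYYX ^ 3 * v$YYYZ + v$ZZZX ^ 3 * v$ZZZZ)"
| "quartic_coeff v YYYX = 2 * v$YYXZ * v$XXYY
     + 4 * (v$XXXY ^ 3 * v$XXXX + v$YYYY ^ 3 * v$YYYX + v$ZZZY ^ 3 * v$ZZZX)"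
| "quartic_coeff v YYYZ = 2 * v$YYXZ * v$YYZZ
     + 4 * (v$XXXY ^ 3 * v$XXXZ + v$YYYY ^ 3 * v$YYYZ + v$ZZZY ^ 3 * v$ZZZZ)"
| "quartic_coeff v ZZZX = 2 * v$ZZXY * v$XXZZ
     + 4 * (v$XXXZ ^ 3 * v$XXXX + v$YYYZ ^ 3 * v$YYYX + v$ZZZZ ^ 3 * v$ZZZX)"
| "quartic_coeff v ZZZY = 2 * v$ZZXY * v$YYZZ
     + 4 * (v$XXXZ ^ 3 * v$XXXY + v$YYYZ ^ 3 * v$YYYY + v$ZZZZ ^ 3 * v$ZZZY)"
| "quartic_coeff v XXYY = 2 * v$XXYZ * v$YYXZ + v$XXYY ^ 2
     + 6 * (v$XXXX ^ 2 * v$XXXY ^ 2 + v$YYYX ^ 2 * v$YYYY ^ 2 + v$ZZZX ^ 2 * v$ZZZY ^ 2)"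
| "quartic_coeff v XXZZ = 2 * v$XXYZ * v$ZZXY + v$XXZZ ^ 2
     + 6 * (v$XXXX ^ 2 * v$XXXZ ^ 2 + v$YYYX ^ 2 * v$YYYZ ^ 2 + v$ZZZX ^ 2 * v$ZZZZ ^ 2)"
| "quartic_coeff v YYZZ = 2 * v$YYXZ * v$ZZXY + v$YYZZ ^ 2
     + 6 * (v$XXXY ^ 2 * v$XXXZ ^ 2 + v$YYYY ^ 2 * v$YYYZ ^ 2 + v$ZZZY ^ 2 * v$ZZZZ ^ 2)"
| "quartic_coeff v XXYZ = 2 * v$XXYZ * v$YYZZ + 2 * v$XXYY * v$XXZZ
     + 12 * (v$XXXX ^ 2 * v$XXXY * v$XXXZ + v$YYYX ^ 2 * v$YYYY * v$YYYZ
           + v$ZZZX ^ 2 * v$ZZZY * v$ZZZZ)"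
| "quartic_coeff v YYXZ = 2 * v$YYXZ * v$XXZZ + 2 * v$XXYY * v$YYZZ
     + 12 * (v$XXXX * v$XXXY ^ 2 * v$XXXZ + v$YYYX * v$YYYY ^ 2 * v$YYYZ
           + v$ZZZX * v$ZZZY ^ 2 * v$ZZZZ)"
| "quartic_coeff v ZZXY = 2 * v$ZZXY * v$XXYY + 2 * v$XXZZ * v$YYZZ
     + 12 * (v$XXXX * v$XXXY * v$XXXZ ^ 2 + v$YYYX * v$YYYY * v$YYYZ ^ 2
           + v$ZZZX * v$ZZZY * v$ZZZZ ^ 2)"

lemma linear_form_power4:
  fixes a b c x y z :: "'a::comm_ring_1"
  shows "(a * x + b * y + c * z) ^ 4 =
    a^4 * x^4 + 4 * (a^3 * b) * (x^3 * y) + 4 * (a^3 * c) * (x^3 * z)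
    + 4 * (b^3 * a) * (y^3 * x) + b^4 * y^4 + 4 * (b^3 * c) * (y^3 * z)
    + 4 * (c^3 * a) * (z^3 * x) + 4 * (c^3 * b) * (z^3 * y) + c^4 * z^4
    + 6 * (a^2 * b^2) * (x^2 * y^2) + 6 * (a^2 * c^2) * (x^2 * z^2) + 6 * (b^2 * c^2) * (y^2 * z^2)
    + 12 * (a^2 * b * c) * (x^2 * y * z) + 12 * (a * b^2 * c) * (x * y^2 * z)
    + 12 * (a * b * c^2) * (x * y * z^2)"
  by (simp add: eval_nat_numeral algebra_simps)

lemma quadratic_form_power2:
  fixes a b c d e f x y z :: "'a::comm_ring_1"
  shows "(a * x^2 + b * y^2 + c * z^2 + d * (x * y) + e * (x * z) + f * (y * z)) ^ 2 =
    a^2 * x^4 + 2 * a * d * (x^3 * y) + 2 * a * e * (x^3 * z)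
    + 2 * b * d * (y^3 * x) + b^2 * y^4 + 2 * b * f * (y^3 * z)
    + 2 * c * e * (z^3 * x) + 2 * c * f * (z^3 * y) + c^2 * z^4
    + (2 * a * b + d^2) * (x^2 * y^2) + (2 * a * c + e^2) * (x^2 * z^2)
    + (2 * b * c + f^2) * (y^2 * z^2)
    + (2 * a * f + 2 * d * e) * (x^2 * y * z) + (2 * b * e + 2 * d * f) * (x * y^2 * z)
    + (2 * c * d + 2 * e * f) * (x * y * z^2)"
  by (simp add: eval_nat_numeral algebra_simps)

lemma peval_quartic:
  assumes "\<And>i. p (ix_expo i) = quartic_coeff v i"
  shows "peval 3 4 p x = (peval 3 2 (quad_of v) x)^2
    + (peval 3 1 (lin_of (v$XXXX) (v$XXXY) (v$XXXZ)) x)^4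
    + (peval 3 1 (lin_of (v$YYYX) (v$YYYY) (v$YYYZ)) x)^4
    + (peval 3 1 (lin_of (v$ZZZX) (v$ZZZY) (v$ZZZZ)) x)^4"
proof -
  have lin: "peval 3 1 (lin_of a b c) x = a * x 0 + b * x 1 + c * x 2" for a b c
    unfolding peval_3_1 by (simp add: lin_of_def)
  have quad: "peval 3 2 (quad_of v) x = v$XXYZ * x 0 ^ 2 + v$YYXZ * x 1 ^ 2 + v$ZZXY * x 2 ^ 2
    + v$XXYY * (x 0 * x 1) + v$XXZZ * (x 0 * x 2) + v$YYZZ * (x 1 * x 2)"
    unfolding peval_3_2 by (simp add: quad_of_def)
  show ?thesis
    unfolding peval_3_4 lin quad assms linear_form_power4 quadratic_form_power2 quartic_coeff.simps
    by (simp only: distrib_left distrib_right add_ac mult_ac)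
qed

section \<open>The coefficient map and its derivative at the base point\<close>

definition quartic_map :: "complex^ix \<Rightarrow> complex^ix" where
  "quartic_map v = (\<chi> i. quartic_coeff v i)"

lemma quartic_map_poly_map: "(\<lambda>v. quartic_map v $ i) \<in> poly_map"
  unfolding quartic_map_def
  by (cases i; simp; intro poly_map.intros poly_map_power)

text \<open>The coordinates of \<open>q = xy + xz + yz\<close> together with the linear forms \<open>x\<close>, \<open>y\<close>, \<open>z\<close>.\<close>

definition base_point :: "complex^ix" where
  "base_point = (\<chi> i. if i \<in> {XXXX, YYYY, ZZZZ, XXYY, XXZZ, YYZZ} then 1 else 0)"

text \<open>The coefficients of 2 q h0 + 4 (x^3 h1 + y^3 h2 + z^3 h3) for q = xy + xz + yz, where
  the quadratic form h0 and the linear forms h1, h2, h3 are the components of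
  \<open>h\<close>.\<close>

fun quartic_deriv :: "complex^ix \<Rightarrow> ix \<Rightarrow> complex" where
  "quartic_deriv h XXXX = 4 * h$XXXX"
| "quartic_deriv h YYYY = 4 * h$YYYY"
| "quartic_deriv h ZZZZ = 4 * h$ZZZZ"
| "quartic_deriv h XXXY = 2 * h$XXYZ + 4 * h$XXXY"
| "quartic_deriv h XXXZ = 2 * h$XXYZ + 4 * h$XXXZ"
| "quartic_deriv h YYYX = 2 * h$YYXZ + 4 * h$YYYX"
| "quartic_deriv h YYYZ = 2 * h$YYXZ + 4 * h$YYYZ"
| "quartic_deriv h ZZZX = 2 * h$ZZXY + 4 * h$ZZZX"
| "quartic_deriv h ZZZY = 2 * h$ZZXY + 4 * h$ZZZY"
| "quartic_deriv h XXYY = 2 * h$XXYY"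
| "quartic_deriv h XXZZ = 2 * h$XXZZ"
| "quartic_deriv h YYZZ = 2 * h$YYZZ"
| "quartic_deriv h XXYZ = 2 * h$XXYZ + 2 * h$XXYY + 2 * h$XXZZ"
| "quartic_deriv h YYXZ = 2 * h$YYXZ + 2 * h$XXYY + 2 * h$YYZZ"
| "quartic_deriv h ZZXY = 2 * h$ZZXY + 2 * h$XXZZ + 2 * h$YYZZ"

lemma quartic_map_has_derivative:
  "(quartic_map has_derivative (\<lambda>h. \<chi> i. quartic_deriv h i)) (at base_point)"
proof (rule has_derivative_vec_componentwise)
  fix i
  have nth: "((\<lambda>v. v $ j) has_derivative (\<lambda>h. h $ j)) F" for j :: ix and F :: "(complex^ix) filter"
    by (rule bounded_linear_imp_has_derivative) (rule bounded_linear_vec_nth)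
  show "((\<lambda>v. quartic_map v $ i) has_derivative (\<lambda>h. (\<chi> i. quartic_deriv h i) $ i)) (at base_point)"
    unfolding quartic_map_def vec_lambda_beta
    by (cases i; simp only: quartic_coeff.simps quartic_deriv.simps;
        rule has_derivative_eq_rhs, (rule derivative_intros nth)+;
        simp add: base_point_def fun_eq_iff algebra_simps)
qed

text \<open>The system is triangular: the equations at \<open>XXXX\<close>, \<open>XXYY\<close> and
  their analogues each contain one unknown; then those at \<open>XXYZ\<close>, \<open>YYXZ\<close>,
  \<open>ZZXY\<close> remove the square terms of the quadratic form, and the other six remove the
  remaining coefficients of the linear forms.\<close>

lemma quartic_deriv_injective:
  assumes "(\<chi> i. quartic_deriv h i) = 0"
  shows "h = 0"
proof -
  have *: "quartic_deriv h i = 0" for i using assms by (simp add: vec_eq_iff)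
  note eqs = *[of XXXX] *[of XXXY] *[of XXXZ] *[of YYYX] *[of YYYY] *[of YYYZ]
    *[of ZZZX] *[of ZZZY] *[of ZZZZ] *[of XXYY] *[of XXZZ] *[of YYZZ] *[of XXYZ] *[of YYXZ] *[of ZZXY]
  have "h $ i = 0" for i using eqs by (cases i) simp_all
  then show ?thesis by (simp add: vec_eq_iff)
qed

text \<open>Carries a polynomial in finitely many coordinates over to a polynomial in the
  coefficients of a form, as the Zariski topology on \<open>H d n\<close> requires.\<close>

lemma poly_fun_poly_map:
  assumes "f \<in> poly_map"
  shows "(\<lambda>p. f (\<chi> i. p (e i))) \<in> poly_fun"
  using assms by induction (auto intro: poly_fun.intros)

theorem theorem1p10:
  shows "general 4 3 (\<lambda>p. \<exists>q \<in> H 2 3. \<exists>l1 \<in> H 1 3. \<exists>l2 \<in> H 1 3. \<exists>l3 \<in> H 1 3.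
            \<forall>x. peval 3 4 p x = (peval 3 2 q x)^2 + (peval 3 1 l1 x)^4
                                + (peval 3 1 l2 x)^4 + (peval 3 1 l3 x)^4)"
proof -
  obtain c where c: "c \<in> poly_map" "\<exists>y. c y \<noteq> 0" "\<forall>y. c y \<noteq> 0 \<longrightarrow> y \<in> range quartic_map"
    by (rule poly_map_image_contains_nonvanishing_locus[OF quartic_map_poly_map
          quartic_map_has_derivative quartic_deriv_injective])
  define f where "f p = c (\<chi> i. p (ix_expo i))" for p
  define U where "U = {p \<in> H 4 3. f p \<noteq> 0}"
  have "f \<in> poly_fun" unfolding f_def using c(1) by (rule poly_fun_poly_map)
  moreover have "H 4 3 - U = {p \<in> H 4 3. \<forall>g\<in>{f}. g p = 0}" by (auto simp: U_def)
  ultimately have "zariski_closed 4 3 (H 4 3 - U)" unfolding zariski_closed_def by blast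
  then have "zariski_open 4 3 U" by (auto simp: zariski_open_def U_def)
  moreover have "U \<noteq> {}"
  proof -
    obtain y where y: "c y \<noteq> 0" using c(2) by blast
    \<comment> \<open>The quartic with coefficient vector \<open>y\<close>; the default 0 away from
      the fifteen exponent vectors puts it into \<open>H 4 3\<close>.\<close>
    define p where "p \<alpha> = (if \<alpha> \<in> range ix_expo then y $ inv ix_expo \<alpha> else 0)" for \<alpha>
    have "(\<chi> i. p (ix_expo i)) = y" by (simp add: vec_eq_iff p_def inv_f_f inj_ix_expo)
    moreover have "p \<in> H 4 3" using ix_expo_monomial by (auto simp: H_def p_def)
    ultimately have "p \<in> U" using y by (simp add: U_def f_def)
    then show ?thesis by blast
  qed
  moreover have "\<exists>q \<in> H 2 3. \<exists>l1 \<in> H 1 3. \<exists>l2 \<in> H 1 3. \<exists>l3 \<in> H 1 3.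
      \<forall>x. peval 3 4 p x = (peval 3 2 q x)^2 + (peval 3 1 l1 x)^4
        + (peval 3 1 l2 x)^4 + (peval 3 1 l3 x)^4" if "p \<in> U" for p
  proof -
    have "c (\<chi> i. p (ix_expo i)) \<noteq> 0" using that by (simp add: U_def f_def)
    then obtain v where "(\<chi> i. p (ix_expo i)) = quartic_map v" using c(3) by blast
    then have "p (ix_expo i) = quartic_coeff v i" for i
      by (simp add: quartic_map_def vec_eq_iff)
    from peval_quartic[OF this] show ?thesis using quad_of_H lin_of_H by blast
  qed
  ultimately show ?thesis unfolding general_def by blast
qed

end
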